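(* Let $R$ be an integral domain such that $R/(m)$ is finite for every $m\in R\setminus\{0\}$, and let $K$ be its field of fractions. The partial action $\theta$ of $K\rtimes K^\times$ on $\hat R_K$ (described in the context) is topologically free if, and only if, $R$ is not a field.
   Context: An integral domain is a unital commutative ring without zero divisors. $K^\times=K\setminus\{0\}$. The group $K\rtimes K^\times$ consists of pairs $(u,w)$, $u\in K$, $w\in K^\times$, with $(u,w)(u',w')=(u+u'w,ww')$, $(u,w)^{-1}=(-u/w,1/w)$ and identity $(0,1)$. The ring $\hat R_K$. For $w,w'\in K^\times$ write $w\le w'$ if $w'=wr$ for some $r\in R$, and let $(w)=wR\subseteq K$. If $w\le w'$ let $p_{w,w'}:(R+(w'))/(w')\to(R+(w))/(w)$ be the canonical projection. Then $$\hat R_K=\Big\{(u_w+(w))_w\in\prod_{w\in K^\times}(R+(w))/(w) : p_{w,w'}(u_{w'}+(w'))=u_w+(w)\text{ whenever } w\le w'\Big\},$$ with the topology induced by the product topology, each $(R+(w))/(w)$ being discrete; it is a compact Hausdorff space. The partial action $\theta$ of $K\rtimes K^\times$ on $\hat R_K$. For $(u,w)\in K\rtimes K^\times$, $\hat R_{(u,w)}=\{(u_{w'}+(w'))_{w'}\in\hat R_K : u_w+(w)=u+(w)\}$ (equality of cosets in $K$; a clopen set), and $\theta_{(u,w)}:\hat R_{(u,w)^{-1}}\to\hat R_{(u,w)}$ is the homeomorphism $\theta_{(u,w)}((u_{w'}+(w'))_{w'})=(u+wu_{w^{-1}w'}+(w'))_{w'}$. A partial action $\theta=(\theta_g:X_{g^{-1}}\to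 X_g)_{g\in G}$ of a discrete group $G$ on a space $X$ is topologically free if, for every $g\in G\setminus\{e\}$, the set $F_g=\{x\in X_{g^{-1}} : \theta_g(x)=x\}$ has empty interior. *)

theory Defs
  imports
    "HOL-Analysis.Analysis"
    "HOL-Algebra.Group"
    "HOL-Computational_Algebra.Polynomial_Factorial"
    "HOL-Library.Set_Algebras"
begin

text \<open>
  The integral domain \<open>R\<close> is a type \<open>'a::idom\<close>, its field of fractions \<open>K\<close> is the type
  \<open>'a fract\<close>, and \<open>R\<close> sits inside \<open>K\<close> as \<open>range to_fract\<close>. Cosets are subsets of \<open>K\<close>; the
  operations \<open>+o\<close>, \<open>*o\<close> (element with set) and \<open>+\<close> (set with set) are the
  elementwise ones.
\<close>

abbreviation nonzero :: "'k::zero set"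
  where "nonzero \<equiv> UNIV - {0}"

definition semidirect :: "('k::field \<times> 'k) monoid"
  where "semidirect =
    \<lparr>carrier = UNIV \<times> nonzero,
     monoid.mult = (\<lambda>(u, w) (u', w'). (u + u' * w, w * w')),
     one = (0, 1)\<rparr>"

lemma group_semidirect: "group (semidirect :: ('k::field \<times> 'k) monoid)"
proof (rule groupI)
  fix x :: "'k \<times> 'k"
  assume "x \<in> carrier semidirect"
  then show "\<exists>y\<in>carrier semidirect. y \<otimes>\<^bsub>semidirect\<^esub> x = \<one>\<^bsub>semidirect\<^esub>"
    by (intro bexI [of _ "(- fst x / snd x, 1 / snd x)"])
      (auto simp: semidirect_def)
qed (auto simp: semidirect_def algebra_simps)

lemma inv_semidirect:
  fixes u w :: "'k::field"
  assumes "w \<noteq> 0"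
  shows "inv\<^bsub>semidirect\<^esub> (u, w) = (- u / w, 1 / w)"
  using assms
  by (intro group.inv_equality [OF group_semidirect]) (auto simp: semidirect_def)

definition quotient_ring :: "'a::idom \<Rightarrow> 'a set set"
  where "quotient_ring m = range (\<lambda>a. a +o range ((*) m))"

definition frac_le :: "'a::idom fract \<Rightarrow> 'a fract \<Rightarrow> bool"
  where "frac_le w w' \<longleftrightarrow> (\<exists>r\<in>range to_fract. w' = w * r)"

definition frac_ideal :: "'a::idom fract \<Rightarrow> 'a fract set"
  where "frac_ideal w = w *o range to_fract"

definition frac_quotient :: "'a::idom fract \<Rightarrow> 'a fract set set"
  where "frac_quotient w = (\<lambda>u. u +o frac_ideal w) ` (range to_fract + frac_ideal w)"

text \<open>
  If \<open>frac_le w w'\<close> then \<open>frac_ideal w' \<subseteq> frac_ideal w\<close>, and the canonical projection takes a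
  coset of \<open>frac_ideal w'\<close> to the coset of \<open>frac_ideal w\<close> containing it.
\<close>

definition canonical_proj :: "'a::idom fract \<Rightarrow> 'a fract set \<Rightarrow> 'a fract set"
  where "canonical_proj w C = C + frac_ideal w"

lemma canonical_proj_coset:
  assumes "frac_le w w'"
  shows "canonical_proj w (u +o frac_ideal w') = u +o frac_ideal w"
proof -
  obtain s where s: "w' = w * to_fract s"
    using assms by (auto simp: frac_le_def)
  have "u + w' * to_fract r + w * to_fract t = u + w * to_fract (s * r + t)" for r t
    by (simp add: s algebra_simps)
  moreover have "u + w * to_fract t = u + w' * to_fract 0 + w * to_fract t" for t
    by simp
  ultimately show ?thesis
    unfolding canonical_proj_def frac_ideal_def elt_set_plus_def elt_set_times_def set_plus_def
    by (safe; blast)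
qed

definition hatR :: "('a::idom fract \<Rightarrow> 'a fract set) set"
  where "hatR = {x \<in> Pi\<^sub>E nonzero frac_quotient.
    \<forall>w\<in>nonzero. \<forall>w'\<in>nonzero. frac_le w w' \<longrightarrow> canonical_proj w (x w') = x w}"

definition hatR_topology :: "('a::idom fract \<Rightarrow> 'a fract set) topology"
  where "hatR_topology =
    subtopology (product_topology (\<lambda>w. discrete_topology (frac_quotient w)) nonzero) hatR"

definition hatR_dom :: "'a::idom fract \<times> 'a fract \<Rightarrow> ('a fract \<Rightarrow> 'a fract set) set"
  where "hatR_dom = (\<lambda>(u, w). {x \<in> hatR. x w = u +o frac_ideal w})"

definition theta ::
    "'a::idom fract \<times> 'a fract \<Rightarrow> ('a fract \<Rightarrow> 'a fract set) \<Rightarrow> 'a fract \<Rightarrow> 'a fract set"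
  where "theta = (\<lambda>(u, w) x. \<lambda>w'\<in>nonzero. u +o (w *o x (inverse w * w')))"

text \<open>
  A partial action of \<open>G\<close> on \<open>X\<close> is given by the family of domains \<open>D g\<close> and the maps
  \<open>\<theta> g\<close> from \<open>D (inv\<^bsub>G\<^esub> g)\<close> to \<open>D g\<close>; the values of \<open>\<theta> g\<close> elsewhere are irrelevant.
\<close>

definition topologically_free ::
    "('g, 'm) monoid_scheme \<Rightarrow> 'x topology \<Rightarrow> ('g \<Rightarrow> 'x set) \<Rightarrow> ('g \<Rightarrow> 'x \<Rightarrow> 'x) \<Rightarrow> bool"
  where "topologically_free G X D \<theta> \<longleftrightarrow>
    (\<forall>g\<in>carrier G - {\<one>\<^bsub>G\<^esub>}. X interior_of {x \<in> D (inv\<^bsub>G\<^esub> g). \<theta> g x = x} = {})"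

end

theory Submission
  imports Defs
begin

text \<open>
  The ring \<open>R\<close> maps into \<open>hatR\<close> by sending \<open>a\<close> to the family of its cosets, and \<open>\<theta>\<close> acts on
  the image by the affine maps \<open>a \<mapsto> u + w a\<close>. Any nonempty open set contains the image of a
  whole coset \<open>b + s R\<close> with \<open>s \<noteq> 0\<close>: finitely many coordinates are all determined by one
  coordinate \<open>s\<close> that is a common multiple of their indices
  (\<open>open_contains_coset_families\<close>).

  If \<open>R\<close> is not a field, the ideals \<open>(w)\<close> have intersection zero, so an element of \<open>K\<close> is
  determined by its cosets (\<open>coset_family_inj\<close>). Hence an affine map that fixes an open set
  pointwise fixes in particular the two distinct elements \<open>b\<close> and \<open>b + s\<close> of \<open>K\<close>, and an affine
  map of \<open>K\<close> with two fixed points is the identity.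

  If \<open>R\<close> is a field, all the ideals \<open>(w)\<close> equal \<open>K\<close>, so \<open>hatR\<close> is a single point, which the
  translation by \<open>1\<close> fixes.
\<close>

section \<open>Cosets of the fractional ideals\<close>

lemma mem_frac_ideal: "z \<in> frac_ideal w \<longleftrightarrow> (\<exists>r. z = w * to_fract r)"
  by (auto simp: frac_ideal_def elt_set_times_def)

lemma mem_frac_coset: "z \<in> u +o frac_ideal w \<longleftrightarrow> (\<exists>r. z = u + w * to_fract r)"
  by (auto simp: elt_set_plus_def mem_frac_ideal)

lemma frac_coset_eq_iff: "u +o frac_ideal w = v +o frac_ideal w \<longleftrightarrow> u - v \<in> frac_ideal w"
proof
  assume eq: "u +o frac_ideal w = v +o frac_ideal w"
  have "u \<in> u +o frac_ideal w"
    by (auto simp: mem_frac_coset intro: exI [of _ 0])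
  then show "u - v \<in> frac_ideal w"
    unfolding eq by (auto simp: mem_frac_coset mem_frac_ideal)
next
  assume "u - v \<in> frac_ideal w"
  then obtain r where "u = v + w * to_fract r"
    by (metis mem_frac_ideal add.commute diff_add_cancel)
  then have "u + w * to_fract t = v + w * to_fract (r + t)"
    and "v + w * to_fract t = u + w * to_fract (t - r)" for t
    by (simp_all add: algebra_simps)
  then show "u +o frac_ideal w = v +o frac_ideal w"
    unfolding set_eq_iff mem_frac_coset by metis
qed

lemma elt_set_times_frac_coset:
  fixes w :: "'a::idom fract"
  shows "w *o (a +o frac_ideal v) = (w * a) +o frac_ideal (w * v)"
  by (auto simp: set_eq_iff mem_frac_coset elt_set_times_def Bex_def algebra_simps)

text \<open>
  Clearing denominators: the product of the numerators is a multiple of every fraction.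
\<close>

lemma finite_frac_common_multiple:
  fixes F :: "'a::idom fract set"
  assumes "finite F" "F \<subseteq> nonzero"
  shows "\<exists>s. s \<noteq> 0 \<and> (\<forall>w\<in>F. frac_le w (to_fract s))"
  using assms
proof (induction F rule: finite_induct)
  case empty
  show ?case
    by (auto intro: exI [of _ 1])
next
  case (insert v F)
  then obtain s where s: "s \<noteq> 0" "\<forall>w\<in>F. frac_le w (to_fract s)"
    by auto
  obtain a b where v: "v = Fract a b" "b \<noteq> 0"
    by (cases v) auto
  have ab: "v * to_fract b = to_fract a"
    using v by (simp add: to_fract_def eq_fract)
  have "a \<noteq> 0"
    using insert.prems v by (auto simp: Zero_fract_def eq_fract)
  moreover have "frac_le v (to_fract (s * a))"
    unfolding frac_le_def
  proof (rule bexI)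
    have "to_fract (s * a) = to_fract s * (v * to_fract b)"
      by (simp add: ab)
    then show "to_fract (s * a) = v * to_fract (b * s)"
      by (simp add: mult_ac)
  qed (rule rangeI)
  moreover have "frac_le w (to_fract (s * a))" if "w \<in> F" for w
  proof -
    obtain r where "to_fract s = w * to_fract r"
      using s \<open>w \<in> F\<close> by (auto simp: frac_le_def)
    then show ?thesis
      unfolding frac_le_def by (intro bexI [of _ "to_fract (r * a)"] rangeI) simp
  qed
  ultimately show ?case
    using s by (intro exI [of _ "s * a"]) auto
qed

section \<open>The image of the ring in its completion\<close>

definition coset_family :: "'a::idom fract \<Rightarrow> 'a fract \<Rightarrow> 'a fract set"
  where "coset_family a = (\<lambda>w\<in>nonzero. a +o frac_ideal w)"

lemma coset_family_in_hatR: "coset_family (to_fract a) \<in> hatR"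
proof -
  have "to_fract a \<in> range to_fract + frac_ideal w" for w
    using set_plus_intro [of "to_fract a" "range to_fract" 0 "frac_ideal w"]
    by (auto simp: mem_frac_ideal intro: exI [of _ 0])
  then show ?thesis
    by (auto simp: hatR_def coset_family_def frac_quotient_def canonical_proj_coset)
qed

lemma theta_coset_family:
  assumes "w \<noteq> 0"
  shows "theta (u, w) (coset_family a) = coset_family (u + w * a)"
proof -
  have "u +o (w *o coset_family a (inverse w * v)) = (u + w * a) +o frac_ideal v"
    if "v \<in> nonzero" for v
  proof -
    have "inverse w * v \<in> nonzero"
      using assms that by simp
    then have "coset_family a (inverse w * v) = a +o frac_ideal (inverse w * v)"
      by (simp add: coset_family_def)
    moreover have "w * (inverse w * v) = v"
      using assms by (simp add: mult.assoc [symmetric])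
    ultimately show ?thesis
      by (simp only: elt_set_times_frac_coset set_plus_rearrange2)
  qed
  then show ?thesis
    unfolding theta_def coset_family_def [of "u + w * a"] prod.case by (rule restrict_ext)
qed

text \<open>
  A nonzero \<open>z\<close> in every \<open>(w)\<close> lies in \<open>(z r)\<close> for every nonzero \<open>r\<close> of \<open>R\<close>, and this makes
  \<open>r\<close> a unit.
\<close>

lemma coset_family_inj:
  fixes r :: "'a::idom"
  assumes r: "r \<noteq> 0" "\<not> (\<exists>y. r * y = 1)"
    and eq: "coset_family a = coset_family (b :: 'a fract)"
  shows "a = b"
proof (rule ccontr)
  assume "a \<noteq> b"
  define z where "z = a - b"
  have z: "z \<noteq> 0"
    using \<open>a \<noteq> b\<close> by (simp add: z_def)
  then have "z * to_fract r \<in> nonzero"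
    using r by simp
  then have "z \<in> frac_ideal (z * to_fract r)"
    using fun_cong [OF eq, of "z * to_fract r"]
    by (simp add: coset_family_def frac_coset_eq_iff z_def)
  then obtain t where "z = z * to_fract (r * t)"
    by (auto simp: mem_frac_ideal mult.assoc)
  with z have "to_fract (r * t) = 1"
    by simp
  then have "r * t = 1"
    by (metis to_fract_1 to_fract_eq_iff)
  with r show False
    by blast
qed

lemma topspace_hatR_topology [simp]: "topspace hatR_topology = hatR"
  by (auto simp: hatR_topology_def hatR_def)

text \<open>
  A basic open set constrains finitely many coordinates. The coordinate at a common multiple
  \<open>s\<close> of their indices determines them all, and it is the coset of some \<open>b\<close> in \<open>R\<close>, since
  every element of \<open>R + (s)\<close> is congruent modulo \<open>(s)\<close> to an element of \<open>R\<close>.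
\<close>

lemma open_contains_coset_families:
  fixes U :: "('a::idom fract \<Rightarrow> 'a fract set) set"
  assumes "openin hatR_topology U" "y \<in> U"
  shows "\<exists>s b. s \<noteq> 0 \<and> (\<forall>t. coset_family (to_fract (b + s * t)) \<in> U)"
proof -
  obtain V where V: "openin (product_topology (\<lambda>w. discrete_topology (frac_quotient w)) nonzero) V"
    and U: "U = V \<inter> hatR"
    using assms(1) by (auto simp: hatR_topology_def openin_subtopology)
  obtain N where N: "finite {w \<in> nonzero. N w \<noteq> frac_quotient w}"
    and yN: "y \<in> Pi\<^sub>E nonzero N" and NV: "Pi\<^sub>E nonzero N \<subseteq> V"
    using V assms(2) U by (auto simp: openin_product_topology_alt)
  obtain s where s: "s \<noteq> 0"
    and le: "\<And>w. w \<noteq> 0 \<Longrightarrow> N w \<noteq> frac_quotient w \<Longrightarrow> frac_le w (to_fract s)"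
    using finite_frac_common_multiple [OF N Collect_restrict] by auto
  have y: "y \<in> hatR"
    using assms(2) U by simp
  then have "y (to_fract s) \<in> frac_quotient (to_fract s)"
    using s by (auto simp: hatR_def)
  then obtain b r where "y (to_fract s) = (to_fract b + to_fract s * to_fract r) +o frac_ideal (to_fract s)"
    by (auto simp: frac_quotient_def set_plus_def mem_frac_ideal)
  then have yb: "y (to_fract s) = to_fract b +o frac_ideal (to_fract s)"
    by (auto simp: frac_coset_eq_iff mem_frac_ideal)
  have "coset_family (to_fract (b + s * t)) \<in> U" for t
  proof -
    have "coset_family (to_fract (b + s * t)) w \<in> N w" if w: "w \<in> nonzero" for w
    proof (cases "N w = frac_quotient w")
      case True
      then show ?thesis
        using coset_family_in_hatR [of "b + s * t"] w by (auto simp: hatR_def)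
    next
      case False
      with w le have l: "frac_le w (to_fract s)"
        by auto
      have "y w = canonical_proj w (y (to_fract s))"
        using y l w s by (auto simp: hatR_def)
      also have "\<dots> = to_fract b +o frac_ideal w"
        unfolding yb by (rule canonical_proj_coset [OF l])
      also have "\<dots> = canonical_proj w (to_fract b +o frac_ideal (to_fract s))"
        by (rule canonical_proj_coset [OF l, symmetric])
      also have "to_fract b +o frac_ideal (to_fract s)
          = to_fract (b + s * t) +o frac_ideal (to_fract s)"
        unfolding frac_coset_eq_iff mem_frac_ideal by (rule exI [of _ "- t"]) simp
      also have "canonical_proj w \<dots> = to_fract (b + s * t) +o frac_ideal w"
        by (rule canonical_proj_coset [OF l])
      finally have "coset_family (to_fract (b + s * t)) w = y w"
        using w by (simp add: coset_family_def)
      then show ?thesis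
        using yN w by auto
    qed
    then have "coset_family (to_fract (b + s * t)) \<in> Pi\<^sub>E nonzero N"
      by (auto simp: coset_family_def)
    then show ?thesis
      using NV U coset_family_in_hatR by blast
  qed
  with s show ?thesis
    by blast
qed

section \<open>Topological freeness\<close>

lemma topologically_free_if_nonunit:
  fixes r :: "'a::idom"
  assumes r: "r \<noteq> 0" "\<not> (\<exists>y. r * y = 1)"
  shows "topologically_free (semidirect :: ('a fract \<times> 'a fract) monoid)
    hatR_topology hatR_dom theta"
  unfolding topologically_free_def
proof (intro ballI, rule ccontr)
  fix g :: "'a fract \<times> 'a fract"
  assume g: "g \<in> carrier semidirect - {\<one>\<^bsub>semidirect\<^esub>}"
  let ?F = "{x \<in> hatR_dom (inv\<^bsub>semidirect\<^esub> g). theta g x = x}"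
  assume "hatR_topology interior_of ?F \<noteq> {}"
  then obtain U y where U: "openin hatR_topology U" "y \<in> U" "U \<subseteq> ?F"
    by (auto simp: interior_of_def)
  obtain u w where uw: "g = (u, w)"
    by fastforce
  with g have w: "w \<noteq> 0"
    by (auto simp: semidirect_def)
  obtain s b where s: "s \<noteq> 0" and bs: "\<And>t. coset_family (to_fract (b + s * t)) \<in> U"
    using open_contains_coset_families [OF U(1,2)] by blast
  have fix_bs: "u + w * to_fract (b + s * t) = to_fract (b + s * t)" for t
  proof (rule coset_family_inj [OF r])
    have "theta (u, w) (coset_family (to_fract (b + s * t))) = coset_family (to_fract (b + s * t))"
      using bs [of t] U(3) uw by auto
    then show "coset_family (u + w * to_fract (b + s * t)) = coset_family (to_fract (b + s * t))"
      by (simp add: theta_coset_family w)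
  qed
  have "w * to_fract s = (u + w * to_fract (b + s * 1)) - (u + w * to_fract (b + s * 0))"
    by (simp add: algebra_simps)
  also have "\<dots> = to_fract s"
    unfolding fix_bs by simp
  finally have "w * to_fract s = to_fract s" .
  with s have "w = 1"
    by simp
  with fix_bs [of 0] have "u = 0"
    by simp
  with \<open>w = 1\<close> g uw show False
    by (simp add: semidirect_def)
qed

lemma frac_ideal_eq_UNIV_of_field:
  fixes w :: "'a::idom fract"
  assumes units: "\<And>x::'a. x \<noteq> 0 \<Longrightarrow> \<exists>y. x * y = 1" and "w \<noteq> 0"
  shows "frac_ideal w = UNIV"
proof -
  have "z \<in> frac_ideal w" for z
  proof -
    obtain a b where ab: "z / w = Fract a b" "b \<noteq> 0"
      by (cases "z / w") auto
    obtain c where "b * c = 1"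
      using units ab(2) by blast
    then have "z / w = to_fract (a * c)"
      using ab by (simp add: to_fract_def eq_fract mult_ac)
    then show ?thesis
      using \<open>w \<noteq> 0\<close> unfolding mem_frac_ideal by (metis nonzero_mult_div_cancel_left times_divide_eq_right)
  qed
  then show ?thesis
    by blast
qed

lemma not_topologically_free_of_field:
  assumes units: "\<And>x::'a::idom. x \<noteq> 0 \<Longrightarrow> \<exists>y. x * y = 1"
  shows "\<not> topologically_free (semidirect :: ('a fract \<times> 'a fract) monoid)
    hatR_topology hatR_dom theta"
proof
  assume free: "topologically_free (semidirect :: ('a fract \<times> 'a fract) monoid)
    hatR_topology hatR_dom theta"
  have UNIV_coset: "u +o UNIV = UNIV" for u :: "'a fract"
    by (auto simp: elt_set_plus_def intro: exI [of _ "_ - u"])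
  have one_times: "1 *o A = A" for A :: "'a fract set"
    by (simp add: elt_set_times_def)
  have ideal: "frac_ideal w = UNIV" if "w \<noteq> 0" for w :: "'a fract"
    using frac_ideal_eq_UNIV_of_field units that by blast
  have coord: "x w = UNIV" if "x \<in> hatR" "w \<noteq> 0" for x and w :: "'a fract"
    using that by (auto simp: hatR_def frac_quotient_def ideal UNIV_coset dest!: PiE_mem [where x = w])
  have "theta (1, 1) x = x" if "x \<in> hatR" for x :: "'a fract \<Rightarrow> 'a fract set"
  proof
    show "theta (1, 1) x w = x w" for w
      using that coord [OF that]
      by (cases "w = 0") (auto simp: theta_def one_times UNIV_coset hatR_def dest: PiE_arb)
  qed
  moreover have "hatR_dom (inv\<^bsub>semidirect\<^esub> (1, 1)) = (hatR :: ('a fract \<Rightarrow> 'a fract set) set)"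
    by (auto simp: inv_semidirect hatR_dom_def ideal UNIV_coset coord)
  ultimately have "{x \<in> hatR_dom (inv\<^bsub>semidirect\<^esub> (1, 1)). theta (1, 1) x = x}
      = topspace (hatR_topology :: ('a fract \<Rightarrow> 'a fract set) topology)"
    by auto
  then have "hatR_topology interior_of
      {x \<in> hatR_dom (inv\<^bsub>semidirect\<^esub> (1, 1)). theta (1, 1) x = x} = (hatR :: ('a fract \<Rightarrow> 'a fract set) set)"
    by (metis interior_of_topspace topspace_hatR_topology)
  moreover have "(1, 1) \<in> carrier (semidirect :: ('a fract \<times> 'a fract) monoid) - {\<one>\<^bsub>semidirect\<^esub>}"
    by (simp add: semidirect_def)
  ultimately have "(hatR :: ('a fract \<Rightarrow> 'a fract set) set) = {}"
    using free unfolding topologically_free_def by blast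
  then show False
    using coset_family_in_hatR by blast
qed

theorem proposition4p5:
  assumes "\<And>m::'a::idom. m \<noteq> 0 \<Longrightarrow> finite (quotient_ring m)"
  shows "topologically_free (semidirect :: ('a fract \<times> 'a fract) monoid) hatR_topology hatR_dom theta
    \<longleftrightarrow> \<not> (\<forall>x::'a. x \<noteq> 0 \<longrightarrow> (\<exists>y. x * y = 1))"
  using topologically_free_if_nonunit not_topologically_free_of_field by blast

end
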